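(* There is an absolute constant $C$ such that for all integers $n\ge 3$, $$\frac{n}{6} \le g(n,3) \le C\, n\, (\log_2 n)^{\log_2 7}.$$
   Context: For integers $2\le k\le n$, let $S_n$ denote the set of permutations of $[n]=\{1,\dots,n\}$ (written as sequences), and $S_{n,k}$ the set of all sequences of $k$ distinct elements of $[n]$. A sequence $\kappa\in S_{n,k}$ is a subsequence of a permutation $\pi\in S_n$ if its elements appear in $\pi$ in the same relative order as in $\kappa$. A perfect sequence covering array ${\rm PSCA}(n,k)$ with multiplicity $\lambda$ (a positive integer) is a multiset $X$ of elements of $S_n$ such that every $\kappa\in S_{n,k}$ is a subsequence of exactly $\lambda$ elements of $X$ (counted with multiplicity); such an $X$ has size $\lambda k!$. $g(n,k)$ denotes the smallest $\lambda$ for which a ${\rm PSCA}(n,k)$ with multiplicity $\lambda$ exists. *)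

theory Defs
  imports Complex_Main "HOL-Library.Multiset" "HOL-Library.Sublist"
begin

definition perms_seq :: "nat \<Rightarrow> nat list set" where
  "perms_seq n = {\<pi>. distinct \<pi> \<and> set \<pi> = {1..n}}"

definition kseqs :: "nat \<Rightarrow> nat \<Rightarrow> nat list set" where
  "kseqs n k = {\<kappa>. distinct \<kappa> \<and> length \<kappa> = k \<and> set \<kappa> \<subseteq> {1..n}}"

definition is_PSCA :: "nat \<Rightarrow> nat \<Rightarrow> nat \<Rightarrow> nat list multiset \<Rightarrow> bool" where
  "is_PSCA n k lam X \<longleftrightarrow>
     set_mset X \<subseteq> perms_seq n \<and>
     (\<forall>\<kappa>\<in>kseqs n k. size (filter_mset (\<lambda>\<pi>. subseq \<kappa> \<pi>) X) = lam)"

definition g :: "nat \<Rightarrow> nat \<Rightarrow> nat" where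
  "g n k = (LEAST lam. lam > 0 \<and> (\<exists>X. is_PSCA n k lam X))"

end

(*
  Upper bound.  Let a family of orders on F_q cover every triple l times.  For each of the q + 1
  directions of the affine plane F_q^2 and each order P of the family, take two orders of the
  plane: both order the lines of that direction by P, and inside the lines one uses P and the other
  its reverse.  In a direction whose lines separate a triple x, y, z the triple is covered 2l times;
  a direction joining x to y, or y to z, contributes an additional l, and one joining x to z
  a deficit of 2l.  Since every two points are joined by one direction, the total is 2(q + 1)l.
  Writing f(t) for the multiplicity obtained on 2^t points, f(2s) = 2(2^s + 1) f(s); replacing t by
  the even number t or t + 1 gives f(t) <= 3/2 * 2^t * (t - 1)^(log_2 7).

  Lower bound.  Fix a point z and assign to each other point x the +-1 vector indexed by the 6l
  permutations that records on which side of z the point x lies.  These vectors have pairwise inner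
  products 2l, squared norms 6l, and are orthogonal to the all-ones vector, so together with the
  latter they are n linearly independent vectors in a space of dimension 6l.
*)

theory Submission
  imports Defs "HOL-Algebra.Algebraic_Closure_Type" "HOL-Library.Z2"
begin

section \<open>Strict orders and lists\<close>

text \<open>Only the behaviour of \<open>P\<close> on \<open>A\<close> is constrained, so an order
  can be transported along an injection by mere composition.\<close>

definition strict_order_on :: "'a set \<Rightarrow> ('a \<Rightarrow> 'a \<Rightarrow> bool) \<Rightarrow> bool" where
  "strict_order_on A P \<longleftrightarrow>
     (\<forall>x\<in>A. \<not> P x x) \<and>
     (\<forall>x\<in>A. \<forall>y\<in>A. \<forall>z\<in>A. P x y \<longrightarrow> P y z \<longrightarrow> P x z) \<and>
     (\<forall>x\<in>A. \<forall>y\<in>A. x \<noteq> y \<longrightarrow> P x y \<or> P y x)"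

lemma strict_order_onI:
  assumes "\<And>x. x \<in> A \<Longrightarrow> \<not> P x x"
    and "\<And>x y z. x \<in> A \<Longrightarrow> y \<in> A \<Longrightarrow> z \<in> A \<Longrightarrow> P x y \<Longrightarrow> P y z \<Longrightarrow> P x z"
    and "\<And>x y. x \<in> A \<Longrightarrow> y \<in> A \<Longrightarrow> x \<noteq> y \<Longrightarrow> P x y \<or> P y x"
  shows "strict_order_on A P"
  using assms unfolding strict_order_on_def by blast

lemma strict_order_on_irrefl: "strict_order_on A P \<Longrightarrow> x \<in> A \<Longrightarrow> \<not> P x x"
  by (auto simp: strict_order_on_def)

lemma strict_order_on_trans:
  "strict_order_on A P \<Longrightarrow> P x y \<Longrightarrow> P y z \<Longrightarrow> x \<in> A \<Longrightarrow> y \<in> A \<Longrightarrow> z \<in> A \<Longrightarrow> P x z"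
  unfolding strict_order_on_def by blast

lemma strict_order_on_not_iff:
  "strict_order_on A P \<Longrightarrow> x \<in> A \<Longrightarrow> y \<in> A \<Longrightarrow> x \<noteq> y \<Longrightarrow> \<not> P x y \<longleftrightarrow> P y x"
  unfolding strict_order_on_def by blast

lemma strict_order_on_inj:
  assumes "strict_order_on A P" "inj_on f B" "f ` B \<subseteq> A"
  shows "strict_order_on B (\<lambda>x y. P (f x) (f y))"
  using assms unfolding strict_order_on_def inj_on_def by (simp add: image_subset_iff) blast

section \<open>Lists as orders\<close>

lemma subseq_pairD: "subseq [x, y] l \<Longrightarrow> x \<in> set l \<and> y \<in> set l"
  by (induction l) (auto simp: subseq_singleton_left split: if_splits)

text \<open>The middle element occurs at only one place of a distinct list, so both pairs use that
  occurrence and glue together.\<close>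

lemma subseq_triple_iff:
  assumes "distinct l"
  shows "subseq [x, y, z] l \<longleftrightarrow> subseq [x, y] l \<and> subseq [y, z] l"
  using assms
proof (induction l)
  case (Cons a l)
  then have IH: "subseq [x, y, z] l \<longleftrightarrow> subseq [x, y] l \<and> subseq [y, z] l" and a: "a \<notin> set l"
    by auto
  show ?case
  proof (cases "x = a")
    case True
    then show ?thesis
      using a subseq_pairD[of y z l] by (cases "y = a") (auto simp: subseq_singleton_left)
  next
    case False
    then show ?thesis
      using IH a subseq_pairD[of x y l] by (cases "y = a") auto
  qed
qed simp

lemma strict_order_on_subseq:
  assumes "distinct l"
  shows "strict_order_on (set l) (\<lambda>x y. subseq [x, y] l)"
proof (rule strict_order_onI)
  fix x show "\<not> subseq [x, x] l"
    using assms by (induction l) (auto simp: subseq_singleton_left)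
next
  fix x y z assume "subseq [x, y] l" "subseq [y, z] l"
  then have "subseq [x, y, z] l" by (simp add: subseq_triple_iff assms)
  moreover have "subseq [x, z] [x, y, z]" by simp
  ultimately show "subseq [x, z] l" using subseq_order.trans by blast
next
  fix x y assume "x \<in> set l" "y \<in> set l" "x \<noteq> y"
  then show "subseq [x, y] l \<or> subseq [y, x] l"
    by (induction l) (auto simp: subseq_singleton_left)
qed

lemma strict_order_on_list:
  assumes "finite A" "strict_order_on A P"
  shows "\<exists>l. distinct l \<and> set l = A \<and> sorted_wrt P l"
  using assms
proof (induction A)
  case (insert x A)
  have "strict_order_on A P"
    using insert.prems unfolding strict_order_on_def by blast
  with insert.IH obtain l where l: "distinct l" "set l = A" "sorted_wrt P l" by blast
  \<comment> \<open>Insertion sort: \<open>x\<close> goes between the elements below it and those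
    above it.\<close>
  let ?l = "filter (\<lambda>y. P y x) l @ x # filter (\<lambda>y. P x y) l"
  have "set ?l = insert x A"
    using insert.prems insert.hyps l(2) unfolding strict_order_on_def by auto
  moreover have "distinct ?l"
    using insert.hyps l strict_order_on_not_iff[OF insert.prems] by auto
  moreover have "sorted_wrt P ?l"
    using l(2,3) strict_order_on_trans[OF insert.prems]
    by (auto simp: sorted_wrt_append sorted_wrt_filter)
  ultimately show ?case by blast
qed simp

lemma subseq_pair_sorted_wrt:
  assumes "strict_order_on A P" "set l \<subseteq> A" "sorted_wrt P l" "x \<in> set l" "y \<in> set l" "x \<noteq> y"
  shows "subseq [x, y] l \<longleftrightarrow> P x y"
  using assms(2-)
proof (induction l)
  case (Cons a l)
  then show ?case
    using strict_order_on_not_iff[OF assms(1), of x y] strict_order_on_irrefl[OF assms(1)]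
      subseq_pairD[of x y l]
    by (auto simp: subseq_singleton_left)
qed simp

section \<open>Families of orders covering triples evenly\<close>

text \<open>Sequence covering arrays for \<open>k = 3\<close>, freed from permutations: the carrier
  may be an affine plane, and indexing by \<open>I\<close> lets an order occur repeatedly.\<close>

definition covers_triples :: "'a set \<Rightarrow> nat \<Rightarrow> 'i set \<Rightarrow> ('i \<Rightarrow> 'a \<Rightarrow> 'a \<Rightarrow> bool) \<Rightarrow> bool" where
  "covers_triples A l I P \<longleftrightarrow> finite I \<and> (\<forall>i\<in>I. strict_order_on A (P i)) \<and>
     (\<forall>x\<in>A. \<forall>y\<in>A. \<forall>z\<in>A. distinct [x, y, z] \<longrightarrow> card {i\<in>I. P i x y \<and> P i y z} = l)"

definition covers_pairs :: "'a set \<Rightarrow> nat \<Rightarrow> 'i set \<Rightarrow> ('i \<Rightarrow> 'a \<Rightarrow> 'a \<Rightarrow> bool) \<Rightarrow> bool" where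
  "covers_pairs A l I P \<longleftrightarrow> (\<forall>x\<in>A. \<forall>y\<in>A. x \<noteq> y \<longrightarrow> card {i\<in>I. P i x y} = l)"

text \<open>The condition on pairs follows from the one on triples when \<^term>\<open>A\<close> has at least three
  elements; it is imposed to let the recursion start from a set with two elements.\<close>

definition balanceable :: "'a set \<Rightarrow> nat \<Rightarrow> bool" where
  "balanceable A l \<longleftrightarrow>
     (\<exists>(I::nat set) P. covers_triples A l I P \<and> covers_pairs A (3 * l) I P)"

text \<open>\<open>balanceable\<close> fixes the type of the indices, since a formula cannot
  quantify over types; enumerating the finite index set removes this restriction.\<close>

lemma balanceableI:
  fixes I :: "'i set"
  assumes "covers_triples A l I P" "covers_pairs A (3 * l) I P"
  shows "balanceable A l"
proof -
  have "finite I" using assms(1) by (simp add: covers_triples_def)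
  then obtain h and m :: nat where h: "bij_betw h {0..<m} I"
    using ex_bij_betw_nat_finite by meson
  then have hI: "I = h ` {0..<m}" and inj: "inj_on h {0..<m}"
    by (auto simp: bij_betw_def)
  have card: "card {k. k < m \<and> Q (h k)} = card {i\<in>I. Q i}" for Q
  proof -
    have "{i\<in>I. Q i} = h ` {k. k < m \<and> Q (h k)}" unfolding hI by auto
    moreover have "inj_on h {k. k < m \<and> Q (h k)}" using inj by (rule inj_on_subset) auto
    ultimately show ?thesis by (simp add: card_image)
  qed
  have "h k \<in> I" if "k \<in> {0..<m}" for k
    using that unfolding hI by auto
  then show ?thesis
    unfolding balanceable_def using assms
    by (intro exI[of _ "{0..<m}"] exI[of _ "\<lambda>k. P (h k)"])
       (simp add: covers_triples_def covers_pairs_def card[of "\<lambda>i. P i x y" for x y]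
         card[of "\<lambda>i. P i x y \<and> P i y z" for x y z])
qed

text \<open>Distinct points stay distinct under \<open>f\<close>, so the counts survive. This allows
  rounding the number of points up to a convenient size.\<close>

lemma balanceable_inj:
  assumes "balanceable A l" "inj_on f B" "f ` B \<subseteq> A"
  shows "balanceable B l"
proof -
  obtain I :: "nat set" and P where IP: "covers_triples A l I P" "covers_pairs A (3 * l) I P"
    using assms(1) unfolding balanceable_def by blast
  have f: "f x \<in> A" if "x \<in> B" for x using that assms(3) by blast
  have neq: "f x = f y \<longleftrightarrow> x = y" if "x \<in> B" "y \<in> B" for x y
    using assms(2) that by (auto simp: inj_on_def)
  show ?thesis
  proof (rule balanceableI)
    show "covers_triples B l I (\<lambda>i x y. P i (f x) (f y))"
      using IP(1) f neq strict_order_on_inj[OF _ assms(2,3)]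
      by (simp add: covers_triples_def)
    show "covers_pairs B (3 * l) I (\<lambda>i x y. P i (f x) (f y))"
      using IP(2) f neq by (simp add: covers_pairs_def)
  qed
qed

lemma balanceable_card_le:
  assumes "balanceable A l" "finite A" "finite B" "card B \<le> card A"
  shows "balanceable B l"
proof -
  obtain f where "f ` B \<subseteq> A" "inj_on f B"
    using card_le_inj[OF assms(3,2,4)] by blast
  with assms(1) show ?thesis by (blast intro: balanceable_inj)
qed

text \<open>Two points contain no triple; the pair count 3 is met by three copies of the order and
  three of its reverse.\<close>

lemma balanceable_2: "balanceable {..<2::nat} 1"
proof (rule balanceableI)
  let ?P = "\<lambda>b (x::nat) y. if fst b then x < y else y < x"
  let ?I = "(UNIV :: bool set) \<times> {..<3::nat}"
  have "card {b\<in>?I. ?P b x y} = 3" if "x \<noteq> y" for x y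
  proof -
    have "{b\<in>?I. ?P b x y} = {x < y} \<times> {..<3}"
      using that by auto
    then show ?thesis by simp
  qed
  then show "covers_pairs {..<2} (3 * 1) ?I ?P"
    by (simp add: covers_pairs_def)
  show "covers_triples {..<2} 1 ?I ?P"
    unfolding covers_triples_def
    by (auto intro!: strict_order_onI)
qed

section \<open>Passage between order families and sequence covering arrays\<close>

lemma balanceable_PSCA:
  assumes "balanceable {1..n} l"
  shows "\<exists>M. is_PSCA n 3 l M"
proof -
  obtain I :: "nat set" and P where IP: "covers_triples {1..n} l I P"
    using assms unfolding balanceable_def by blast
  then have I: "finite I" and ord: "\<And>i. i \<in> I \<Longrightarrow> strict_order_on {1..n} (P i)"
    by (auto simp: covers_triples_def)
  have "\<forall>i\<in>I. \<exists>L. distinct L \<and> set L = {1..n} \<and> sorted_wrt (P i) L"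
    using ord by (intro ballI strict_order_on_list) auto
  from bchoice[OF this] obtain L where L: "\<And>i. i \<in> I \<Longrightarrow> distinct (L i)" "\<And>i. i \<in> I \<Longrightarrow> set (L i) = {1..n}"
    "\<And>i. i \<in> I \<Longrightarrow> sorted_wrt (P i) (L i)"
    by blast
  let ?M = "image_mset L (mset_set I)"
  have "size (filter_mset (\<lambda>\<pi>. subseq \<kappa> \<pi>) ?M) = l" if \<kappa>_in: "\<kappa> \<in> kseqs n 3" for \<kappa>
  proof -
    obtain x y z where "\<kappa> = [x, y, z]"
      using \<kappa>_in by (auto simp: kseqs_def length_Suc_conv numeral_3_eq_3)
    with \<kappa>_in have \<kappa>: "\<kappa> = [x, y, z]" "distinct [x, y, z]"
      "x \<in> {1..n}" "y \<in> {1..n}" "z \<in> {1..n}"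
      by (auto simp: kseqs_def)
    have "size (filter_mset (\<lambda>\<pi>. subseq \<kappa> \<pi>) ?M) = card {i\<in>I. subseq \<kappa> (L i)}"
      using I by (simp add: filter_mset_image_mset filter_mset_mset_set)
    also have "{i\<in>I. subseq \<kappa> (L i)} = {i\<in>I. P i x y \<and> P i y z}"
    proof (intro Collect_cong conj_cong refl)
      fix i assume i: "i \<in> I"
      have "subseq [u, v] (L i) \<longleftrightarrow> P i u v" if "u \<in> {1..n}" "v \<in> {1..n}" "u \<noteq> v" for u v
        by (rule subseq_pair_sorted_wrt[OF ord[OF i]]) (use L[OF i] that in auto)
      with L(1)[OF i] \<kappa> show "subseq \<kappa> (L i) \<longleftrightarrow> P i x y \<and> P i y z"
        by (simp add: subseq_triple_iff)
    qed
    also have "card \<dots> = l"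
      using IP \<kappa> unfolding covers_triples_def by blast
    finally show ?thesis .
  qed
  moreover have "set_mset ?M \<subseteq> perms_seq n"
    using L I by (auto simp: perms_seq_def)
  ultimately have "is_PSCA n 3 l ?M" unfolding is_PSCA_def by simp
  then show ?thesis by blast
qed

lemma PSCA_covers_triples:
  assumes "is_PSCA n 3 l M"
  shows "\<exists>(I::nat set) P. covers_triples {1..n} l I P"
proof -
  \<comment> \<open>Indexing by the positions of a list keeps repeated permutations apart.\<close>
  obtain xs where xs: "mset xs = M" using ex_mset by blast
  have d: "distinct (xs ! i)" "set (xs ! i) = {1..n}" if "i < length xs" for i
  proof -
    have "xs ! i \<in> perms_seq n"
      using assms xs that by (metis is_PSCA_def nth_mem set_mset_mset subsetD)
    then show "distinct (xs ! i)" "set (xs ! i) = {1..n}" by (auto simp: perms_seq_def)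
  qed
  have "card {i\<in>{..<length xs}. subseq [x, y] (xs ! i) \<and> subseq [y, z] (xs ! i)} = l"
    if "x \<in> {1..n}" "y \<in> {1..n}" "z \<in> {1..n}" "distinct [x, y, z]" for x y z
  proof -
    have "{i\<in>{..<length xs}. subseq [x, y] (xs ! i) \<and> subseq [y, z] (xs ! i)} =
          {i. i < length xs \<and> subseq [x, y, z] (xs ! i)}"
      using d by (auto simp: subseq_triple_iff)
    also have "card \<dots> = length (filter (\<lambda>\<pi>. subseq [x, y, z] \<pi>) xs)"
      by (simp add: length_filter_conv_card)
    also have "\<dots> = size (filter_mset (\<lambda>\<pi>. subseq [x, y, z] \<pi>) M)"
      by (metis xs mset_filter size_mset)
    also have "[x, y, z] \<in> kseqs n 3" using that by (auto simp: kseqs_def)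
    then have "size (filter_mset (\<lambda>\<pi>. subseq [x, y, z] \<pi>) M) = l"
      using assms unfolding is_PSCA_def by blast
    finally show ?thesis .
  qed
  moreover have "strict_order_on {1..n} (\<lambda>x y. subseq [x, y] (xs ! i))" if "i < length xs" for i
    using strict_order_on_subseq[OF d(1)[OF that]] d(2)[OF that] by simp
  ultimately have "covers_triples {1..n} l {..<length xs} (\<lambda>i x y. subseq [x, y] (xs ! i))"
    unfolding covers_triples_def by simp
  then show ?thesis by blast
qed

text \<open>The orders of the plane are counted direction by direction, adding the two settings of
  the flag, as in general only their sum is determined by \<open>l\<close>.\<close>

lemma card_filter_times_bool:
  assumes "finite D" "finite I"
  shows "card {k \<in> D \<times> I \<times> (UNIV :: bool set). Q k} =
    (\<Sum>d\<in>D. card {i\<in>I. Q (d, i, True)} + card {i\<in>I. Q (d, i, False)})"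
proof -
  have card: "card {k\<in>S. R k} = (\<Sum>k\<in>S. of_bool (R k))" if "finite S" for S :: "'x set" and R
    using that by (simp add: Int_def)
  have "card {k \<in> D \<times> I \<times> (UNIV :: bool set). Q k} = (\<Sum>k\<in>D \<times> I \<times> (UNIV :: bool set). of_bool (Q k))"
    using assms by (intro card) auto
  also have "\<dots> = (\<Sum>d\<in>D. \<Sum>i\<in>I. \<Sum>b\<in>UNIV. of_bool (Q (d, i, b)))"
    by (simp add: sum.cartesian_product split_def del: sum_of_bool_eq)
  also have "\<dots> = (\<Sum>d\<in>D. card {i\<in>I. Q (d, i, True)} + card {i\<in>I. Q (d, i, False)})"
    by (simp add: UNIV_bool sum.distrib card assms add.commute del: sum_of_bool_eq)
  finally show ?thesis .
qed

lemma card_filter_split: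
  assumes "finite I"
  shows "card {i\<in>I. R i} = card {i\<in>I. Q i \<and> R i} + card {i\<in>I. \<not> Q i \<and> R i}"
proof -
  have "{i\<in>I. R i} = {i\<in>I. Q i \<and> R i} \<union> {i\<in>I. \<not> Q i \<and> R i}" by blast
  also have "card \<dots> = card {i\<in>I. Q i \<and> R i} + card {i\<in>I. \<not> Q i \<and> R i}"
    using assms by (intro card_Un_disjoint) auto
  finally show ?thesis .
qed

section \<open>Order families from affine planes\<close>

definition plane_order ::
  "('d \<Rightarrow> 'p \<Rightarrow> 'a) \<Rightarrow> ('d \<Rightarrow> 'p \<Rightarrow> 'a) \<Rightarrow> ('i \<Rightarrow> 'a \<Rightarrow> 'a \<Rightarrow> bool) \<Rightarrow> 'd \<times> 'i \<times> bool \<Rightarrow> 'p \<Rightarrow> 'p \<Rightarrow> bool"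
  where "plane_order L M P k p q = (case k of (d, i, b) \<Rightarrow>
    if L d p = L d q then if b then P i (M d p) (M d q) else P i (M d q) (M d p)
    else P i (L d p) (L d q))"

text \<open>Think of \<^term>\<open>L d p\<close> as the line of direction \<^term>\<open>d\<close> through \<^term>\<open>p\<close>, and of
  \<^term>\<open>M d p\<close> as the position of \<^term>\<open>p\<close> on that line.\<close>

lemma balanceable_plane:
  fixes L M :: "'d \<Rightarrow> 'p \<Rightarrow> 'a"
  assumes F: "balanceable F l" and D: "finite D"
    and LF: "\<And>d p. d \<in> D \<Longrightarrow> p \<in> A \<Longrightarrow> L d p \<in> F"
    and MF: "\<And>d p. d \<in> D \<Longrightarrow> p \<in> A \<Longrightarrow> M d p \<in> F"
    and inj: "\<And>d p q. d \<in> D \<Longrightarrow> p \<in> A \<Longrightarrow> q \<in> A \<Longrightarrow> L d p = L d q \<Longrightarrow> M d p = M d q \<Longrightarrow> p = q"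
    and line: "\<And>p q. p \<in> A \<Longrightarrow> q \<in> A \<Longrightarrow> p \<noteq> q \<Longrightarrow> \<exists>!d. d \<in> D \<and> L d p = L d q"
  shows "balanceable A (2 * card D * l)"
proof -
  obtain I :: "nat set" and P where IP: "covers_triples F l I P" "covers_pairs F (3 * l) I P"
    using F unfolding balanceable_def by blast
  have I: "finite I" and ord: "\<And>i. i \<in> I \<Longrightarrow> strict_order_on F (P i)"
    and triple: "\<And>x y z. x \<in> F \<Longrightarrow> y \<in> F \<Longrightarrow> z \<in> F \<Longrightarrow> distinct [x, y, z] \<Longrightarrow> card {i\<in>I. P i x y \<and> P i y z} = l"
    using IP(1) unfolding covers_triples_def by blast+
  have pair: "\<And>x y. x \<in> F \<Longrightarrow> y \<in> F \<Longrightarrow> x \<noteq> y \<Longrightarrow> card {i\<in>I. P i x y} = 3 * l"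
    using IP(2) unfolding covers_pairs_def by blast
  have neg: "P i x y \<longleftrightarrow> \<not> P i y x" if "i \<in> I" "x \<in> F" "y \<in> F" "x \<noteq> y" for i x y
    using strict_order_on_not_iff[OF ord] that by blast
  have irr: "\<not> P i x x" if "i \<in> I" "x \<in> F" for i x
    using strict_order_on_irrefl[OF ord] that by blast
  have tr: "P i x z" if "i \<in> I" "x \<in> F" "y \<in> F" "z \<in> F" "P i x y" "P i y z" for i x y z
    using strict_order_on_trans[OF ord] that by blast
  let ?I = "D \<times> I \<times> (UNIV :: bool set)"
  let ?R = "plane_order L M P"
  let ?e = "\<lambda>d p q. of_bool (L d p = L d q) :: nat"
  have e: "(\<Sum>d\<in>D. ?e d p q) = 1" if "p \<in> A" "q \<in> A" "p \<noteq> q" for p q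
  proof -
    from line[OF that] obtain d where d: "{d. d \<in> D \<and> L d p = L d q} = {d}" by blast
    have "(\<Sum>d\<in>D. ?e d p q) = card {d. d \<in> D \<and> L d p = L d q}"
      using D by (simp add: Int_def)
    then show ?thesis by (simp add: d)
  qed
  \<comment> \<open>For two points on one line the two flags ask for opposite orientations. Each
    order satisfies exactly one, so the sum leaves only the other condition
    \<open>R\<close>.\<close>
  have both: "card {i\<in>I. P i u v \<and> R i} + card {i\<in>I. P i v u \<and> R i} = card {i\<in>I. R i}"
    if "u \<in> F" "v \<in> F" "u \<noteq> v" for u v R
  proof -
    have "{i\<in>I. P i v u \<and> R i} = {i\<in>I. \<not> P i u v \<and> R i}"
      using neg that by blast
    then show ?thesis using card_filter_split[OF I, of R "\<lambda>i. P i u v"] by simp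
  qed
  have both': "card {i\<in>I. R i \<and> P i u v} + card {i\<in>I. R i \<and> P i v u} = card {i\<in>I. R i}"
    if "u \<in> F" "v \<in> F" "u \<noteq> v" for u v R
    using both[OF that, of R] by (simp add: conj_commute)
  show ?thesis
  proof (rule balanceableI)
    show "covers_pairs A (3 * (2 * card D * l)) ?I ?R"
      unfolding covers_pairs_def
    proof (intro ballI impI)
      fix p q assume pq: "p \<in> A" "q \<in> A" "p \<noteq> q"
      have "card {i\<in>I. ?R (d, i, True) p q} + card {i\<in>I. ?R (d, i, False) p q} = 6 * l"
        if "d \<in> D" for d
      proof (cases "L d p = L d q")
        case True
        then have "M d p \<noteq> M d q" using inj[OF that] pq by blast
        with True show ?thesis
          using pair MF[OF that] pq by (simp add: plane_order_def)
      next
        case False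
        then show ?thesis using pair LF[OF that] pq by (simp add: plane_order_def)
      qed
      then show "card {k\<in>?I. ?R k p q} = 3 * (2 * card D * l)"
        by (simp add: card_filter_times_bool D I)
    qed
    have "strict_order_on A (?R (d, i, b))" if d: "d \<in> D" and i: "i \<in> I" for d i b
    proof (rule strict_order_onI)
      fix p assume "p \<in> A"
      then show "\<not> ?R (d, i, b) p p"
        using irr[OF i MF[OF d]] by (simp add: plane_order_def)
    next
      fix p q assume pq: "p \<in> A" "q \<in> A" "p \<noteq> q"
      then have "L d p = L d q \<longrightarrow> M d p \<noteq> M d q" using inj[OF d] by blast
      with pq show "?R (d, i, b) p q \<or> ?R (d, i, b) q p"
        using neg[OF i LF[OF d] LF[OF d], of p q] neg[OF i MF[OF d] MF[OF d], of p q]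
        by (auto simp: plane_order_def)
    next
      fix p q r assume *: "p \<in> A" "q \<in> A" "r \<in> A" "?R (d, i, b) p q" "?R (d, i, b) q r"
      note L = LF[OF d *(1)] LF[OF d *(2)] LF[OF d *(3)]
      note M = MF[OF d *(1)] MF[OF d *(2)] MF[OF d *(3)]
      \<comment> \<open>Three points on one line use transitivity of positions, forwards or
        reversed. If the line through \<open>p\<close> and \<open>r\<close> misses \<open>q\<close>,
        the premises put \<open>L d p\<close> both before and after \<open>L d q\<close>, which is
        impossible.\<close>
      show "?R (d, i, b) p r"
        using *(4,5) tr[OF i L] tr[OF i M] tr[OF i M(3,2,1)] tr[OF i L(1,2,1)] irr[OF i L(1)]
        by (auto simp: plane_order_def split: if_splits)
    qed
    moreover have "card {k\<in>?I. ?R k p q \<and> ?R k q r} = 2 * card D * l"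
      if pqr: "p \<in> A" "q \<in> A" "r \<in> A" "distinct [p, q, r]" for p q r
    proof -
      define c where "c = (\<lambda>d. card {i\<in>I. ?R (d, i, True) p q \<and> ?R (d, i, True) q r} +
          card {i\<in>I. ?R (d, i, False) p q \<and> ?R (d, i, False) q r})"
      \<comment> \<open>The deficit stands on the left to avoid truncated subtraction. So
        \<open>c d\<close> is \<open>2 * l\<close> if all three points share a line or are pairwise
        separated, \<open>3 * l\<close> if only \<open>p, q\<close> or only \<open>q, r\<close>
        share one, and 0 if only \<open>p, r\<close> do.\<close>
      have c: "c d + 2 * l * ?e d p r = 2 * l + l * ?e d p q + l * ?e d q r" if d: "d \<in> D" for d
      proof -
        note L = LF[OF d pqr(1)] LF[OF d pqr(2)] LF[OF d pqr(3)]
        note M = MF[OF d pqr(1)] MF[OF d pqr(2)] MF[OF d pqr(3)]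
        have ne: "L d p = L d q \<Longrightarrow> M d p \<noteq> M d q" "L d q = L d r \<Longrightarrow> M d q \<noteq> M d r"
          "L d p = L d r \<Longrightarrow> M d p \<noteq> M d r"
          using inj[OF d] pqr by auto
        consider "L d p = L d q" "L d q = L d r" | "L d p = L d q" "L d q \<noteq> L d r"
          | "L d p \<noteq> L d q" "L d q = L d r" | "L d p \<noteq> L d q" "L d q \<noteq> L d r" "L d p = L d r"
          | "L d p \<noteq> L d q" "L d q \<noteq> L d r" "L d p \<noteq> L d r"
          by blast
        then show ?thesis
        proof cases
          case 1
          have "card {i\<in>I. P i (M d q) (M d p) \<and> P i (M d r) (M d q)} = l"
            using triple[OF M(3,2,1)] ne 1 by (simp add: conj_commute)
          with 1 show ?thesis
            using triple[OF M] ne by (simp add: c_def plane_order_def)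
        next
          case 2
          with both[OF M(1,2) ne(1)] pair[OF L(2,3)] show ?thesis
            by (simp add: c_def plane_order_def)
        next
          case 3
          with both'[OF M(2,3) ne(2)] pair[OF L(1,2)] show ?thesis
            by (simp add: c_def plane_order_def)
        next
          case 4
          then have "\<not> (P i (L d p) (L d q) \<and> P i (L d q) (L d p))" if "i \<in> I" for i
            using neg[OF that L(1,2)] by auto
          then have none: "{i\<in>I. P i (L d p) (L d q) \<and> P i (L d q) (L d p)} = {}" by blast
          with 4 show ?thesis by (simp add: c_def plane_order_def none[unfolded 4(3)])
        next
          case 5
          then show ?thesis
            using triple[OF L] by (simp add: c_def plane_order_def)
        qed
      qed
      have "(\<Sum>d\<in>D. c d) + 2 * l * (\<Sum>d\<in>D. ?e d p r) = (\<Sum>d\<in>D. c d + 2 * l * ?e d p r)"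
        by (simp only: sum.distrib sum_distrib_left)
      also have "\<dots> = (\<Sum>d\<in>D. 2 * l + l * ?e d p q + l * ?e d q r)"
        using c by (intro sum.cong) auto
      also have "\<dots> = 2 * l * card D + l * (\<Sum>d\<in>D. ?e d p q) + l * (\<Sum>d\<in>D. ?e d q r)"
        by (simp only: sum.distrib sum_distrib_left sum_constant mult.commute of_nat_id)
      \<comment> \<open>Each indicator sums to 1 over the directions, so the gains
        \<open>l + l\<close> cancel the deficit \<open>2 * l\<close>.\<close>
      finally have "(\<Sum>d\<in>D. c d) = 2 * card D * l"
        using e pqr by (simp del: sum_of_bool_eq)
      then show ?thesis
        by (simp add: card_filter_times_bool D I c_def)
    qed
    ultimately show "covers_triples A (2 * card D * l) ?I ?R"
      using D I by (auto simp: covers_triples_def)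
  qed
qed

text \<open>\<open>F\<close> is a subfield given as a set, so that fields of all sizes needed can
  live in one type. The directions are the slopes in \<open>F\<close> and the vertical one,
  \<open>None\<close>.\<close>

lemma balanceable_square:
  fixes F :: "'a :: field set"
  assumes "balanceable F l" "finite F"
    and diff: "\<And>x y. x \<in> F \<Longrightarrow> y \<in> F \<Longrightarrow> x - y \<in> F"
    and mult: "\<And>x y. x \<in> F \<Longrightarrow> y \<in> F \<Longrightarrow> x * y \<in> F"
    and inverse: "\<And>x. x \<in> F \<Longrightarrow> inverse x \<in> F"
  shows "balanceable (F \<times> F) (2 * (card F + 1) * l)"
proof -
  let ?D = "insert None (Some ` F)"
  \<comment> \<open>\<open>L\<close> labels a vertical line by its abscissa and a line of slope
    \<open>m\<close> by its intercept; \<open>M\<close> is a coordinate that is injective on the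
    line.\<close>
  define L :: "'a option \<Rightarrow> 'a \<times> 'a \<Rightarrow> 'a" where
    "L = (\<lambda>d p. case d of None \<Rightarrow> fst p | Some m \<Rightarrow> snd p - m * fst p)"
  define M :: "'a option \<Rightarrow> 'a \<times> 'a \<Rightarrow> 'a" where
    "M = (\<lambda>d p. case d of None \<Rightarrow> snd p | Some m \<Rightarrow> fst p)"
  have line: "\<exists>!d. d \<in> ?D \<and> L d p = L d q" if pq: "p \<in> F \<times> F" "q \<in> F \<times> F" "p \<noteq> q" for p q
  proof (cases "fst p = fst q")
    case True
    with pq have "snd p \<noteq> snd q" by (auto simp: prod_eq_iff)
    with True show ?thesis by (intro ex1I[of _ None]) (auto simp: L_def)
  next
    case False
    let ?m = "(snd p - snd q) * inverse (fst p - fst q)"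
    have eq: "snd p - m * fst p = snd q - m * fst q \<longleftrightarrow> m = ?m" for m
      using False by (auto simp: field_simps)
    have "?m \<in> F" using pq by (auto intro!: diff mult inverse)
    then show ?thesis
      by (intro ex1I[of _ "Some ?m"]) (auto simp: L_def eq False)
  qed
  have "balanceable (F \<times> F) (2 * card ?D * l)"
  proof (rule balanceable_plane[of F l ?D _ L M])
    show "L d p \<in> F" "M d p \<in> F" if "d \<in> ?D" "p \<in> F \<times> F" for d p
      using that by (auto simp: L_def M_def intro!: diff mult)
    show "p = q" if "d \<in> ?D" "L d p = L d q" "M d p = M d q" for d p q
      using that by (auto simp: L_def M_def prod_eq_iff)
  qed (use assms line in auto)
  also have "card ?D = card F + 1"
    using assms(2) by (simp add: card_image)
  finally show ?thesis .
qed

section \<open>Finite fields of characteristic two\<close>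

text \<open>Without multiple roots, splitting off a linear factor loses exactly one root: for
  \<open>p = (X - x) q\<close> the derivative at \<open>x\<close> is \<open>q(x)\<close>, so
  \<open>x\<close> is not a root of \<open>q\<close>, and at a root \<open>a\<close> of
  \<open>q\<close> it is \<open>(a - x) q'(a)\<close>, so the hypothesis passes to
  \<open>q\<close>.\<close>

lemma card_roots_eq_degree:
  fixes p :: "'a :: alg_closed_field poly"
  assumes "p \<noteq> 0" "\<And>a. poly p a = 0 \<Longrightarrow> poly (pderiv p) a \<noteq> 0"
  shows "card {a. poly p a = 0} = degree p"
  using assms
proof (induction "degree p" arbitrary: p)
  case 0
  then obtain c where "p = [:c:]" by (metis degree_0_id)
  with 0 show ?case by auto
next
  case (Suc n)
  then obtain x where "poly p x = 0"
    using alg_closed_imp_poly_has_root[of p] by auto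
  then obtain q where q: "p = [:-x, 1:] * q"
    by (auto simp: poly_eq_0_iff_dvd)
  have q0: "q \<noteq> 0" using Suc.prems q by auto
  then have deg: "degree p = Suc (degree q)"
    unfolding q by (subst degree_mult_eq) auto
  have der: "poly (pderiv p) a = poly q a + (a - x) * poly (pderiv q) a" for a
    unfolding q pderiv_mult by (simp add: pderiv_pCons algebra_simps)
  have "poly q x \<noteq> 0"
    using Suc.prems(2)[of x] \<open>poly p x = 0\<close> by (simp add: der)
  moreover have "{a. poly p a = 0} = insert x {a. poly q a = 0}"
    unfolding q by auto
  moreover have "card {a. poly q a = 0} = degree q"
  proof (rule Suc.hyps(1))
    show "poly (pderiv q) a \<noteq> 0" if "poly q a = 0" for a
      using Suc.prems(2)[of a] that der[of a] q by auto
  qed (use deg Suc.hyps q0 in auto)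
  ultimately show ?case
    using deg poly_roots_finite[OF q0] by simp
qed

text \<open>Iterated Frobenius map: the cross term \<open>2xy\<close> of each squaring
  vanishes.\<close>

lemma power_2_power_add:
  fixes x y :: "'a :: comm_ring_1"
  assumes "(2 :: 'a) = 0"
  shows "(x + y) ^ (2 ^ s) = x ^ (2 ^ s) + y ^ (2 ^ s)"
proof (induction s)
  case (Suc s)
  have "(x + y) ^ (2 ^ Suc s) = ((x + y) ^ (2 ^ s)) ^ 2"
    by (simp add: mult.commute flip: power_mult)
  also have "\<dots> = (x ^ (2 ^ s)) ^ 2 + (y ^ (2 ^ s)) ^ 2"
    by (simp add: Suc power2_sum assms)
  also have "\<dots> = x ^ (2 ^ Suc s) + y ^ (2 ^ Suc s)"
    by (simp add: mult.commute flip: power_mult)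
  finally show ?case .
qed simp

text \<open>The field with \<open>2 ^ s\<close> elements is realised as the roots of
  \<open>X^q - X\<close>, \<open>q = 2 ^ s\<close>, in the algebraic closure of the field of two
  elements.\<close>

lemma balanceable_power2_double:
  assumes "balanceable {..<2 ^ s :: nat} l" "s > 0"
  shows "balanceable {..<2 ^ (2 * s) :: nat} (2 * (2 ^ s + 1) * l)"
proof -
  have two: "(2 :: bit alg_closure) = 0"
    by (metis to_ac_0 to_ac_numeral bit_numeral_even)
  let ?q = "2 ^ s :: nat"
  have q: "?q > 1" using assms(2) by (intro one_less_power) auto
  define F where "F = {x :: bit alg_closure. x ^ ?q = x}"
  let ?p = "monom 1 ?q - monom 1 1 :: bit alg_closure poly"
  have deg: "degree ?p = ?q"
    using q by (subst diff_conv_add_uminus, subst degree_add_eq_left) (auto simp: degree_monom_eq)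
  \<comment> \<open>As \<open>q\<close> is even, the derivative of \<open>X^q - X\<close> is -1 and
    there are no multiple roots.\<close>
  have "of_nat ?q = (0 :: bit alg_closure)"
    using assms(2) by (simp add: two)
  then have "pderiv ?p = - 1"
    by (simp add: pderiv_diff pderiv_monom monom_0 one_pCons power_0_left)
  then have "card {a. poly ?p a = 0} = ?q"
    using deg q by (subst card_roots_eq_degree) auto
  also have "{a. poly ?p a = 0} = F"
    by (auto simp: F_def poly_monom)
  finally have card: "card F = ?q" .
  then have fin: "finite F" using q card.infinite by fastforce
  have neg: "- x = x" for x :: "bit alg_closure"
    by (metis two add_eq_0_iff mult_2 mult_zero_left)
  have "balanceable F l"
    using balanceable_card_le[OF assms(1) _ fin] card by simp
  then have "balanceable (F \<times> F) (2 * (card F + 1) * l)"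
  proof (rule balanceable_square[OF _ fin])
    show "x - y \<in> F" if "x \<in> F" "y \<in> F" for x y
    proof -
      have "x - y = x + y" by (simp only: diff_conv_add_uminus neg)
      moreover have "x + y \<in> F"
        using that power_2_power_add[OF two, of x y s] by (simp add: F_def)
      ultimately show ?thesis by (simp only:)
    qed
    show "x * y \<in> F" if "x \<in> F" "y \<in> F" for x y
      using that by (simp add: F_def power_mult_distrib)
    show "inverse x \<in> F" if "x \<in> F" for x
      using that by (simp add: F_def power_inverse)
  qed
  then show ?thesis
    using balanceable_card_le[of "F \<times> F" _ "{..<2 ^ (2 * s) :: nat}"] fin card
    by (simp add: card_cartesian_product mult_2 power_add)
qed

section \<open>Upper bound\<close>

text \<open>\<open>2 powr log 2 7 = 7\<close>: halving the argument pays for a factor 7.\<close>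

lemma log27_powr_bounds:
  fixes a b :: real
  assumes "0 \<le> a" "2 * a \<le> b"
  shows "7 * a powr log 2 7 \<le> b powr log 2 7"
proof -
  have "7 * a powr log 2 7 = (2 * a) powr log 2 7"
    using assms by (simp add: powr_mult)
  also have "\<dots> \<le> b powr log 2 7"
    using assms by (intro powr_mono2) auto
  finally show ?thesis .
qed

lemma balanceable_power2:
  assumes "t \<ge> 2"
  shows "\<exists>l>0. balanceable {..<2 ^ t :: nat} l \<and>
           real l \<le> 3 / 2 * 2 ^ t * (real t - 1) powr log 2 7"
  using assms
proof (induction t rule: less_induct)
  case (less t)
  show ?case
  proof (cases "t = 2")
    case True
    \<comment> \<open>The constant 3/2 is chosen to fit this case:
      \<open>6 = 3/2 * 2^2 * 1\<close>.\<close>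
    have "balanceable {..<2 ^ (2 * 1) :: nat} (2 * (2 ^ 1 + 1) * 1)"
      by (rule balanceable_power2_double) (use balanceable_2 in auto)
    with True show ?thesis by (intro exI[of _ 6]) auto
  next
    case False
    define s where "s = (t + 1) div 2"
    have s: "s < t" "2 \<le> s" using False less.prems by (auto simp: s_def)
    from less.IH[OF this] obtain l where l: "l > 0" "balanceable {..<2 ^ s :: nat} l"
      "real l \<le> 3 / 2 * 2 ^ s * (real s - 1) powr log 2 7" by blast
    let ?l = "2 * (2 ^ s + 1) * l"
    have "balanceable {..<2 ^ (2 * s) :: nat} ?l"
      by (rule balanceable_power2_double) (use l s in auto)
    then have "balanceable {..<2 ^ t :: nat} ?l"
      by (rule balanceable_card_le) (auto simp: s_def intro!: power_increasing)
    moreover have "real ?l \<le> 3 / 2 * 2 ^ t * (real t - 1) powr log 2 7"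
    proof -
      have "(2::real) ^ 2 \<le> 2 ^ s" using s by (intro power_increasing) auto
      \<comment> \<open>The factor 7 splits as 7/2, bounding \<open>2 * (2 ^ s + 1) / 2 ^ s\<close>,
        times 2 for rounding \<open>t\<close> up to \<open>2 * s\<close>.\<close>
      then have *: "4 * (2 ^ s + 1) \<le> (7 :: real) * 2 ^ s" by simp
      have st: "2 * s \<le> t + 1" by (simp add: s_def)
      then have "real (2 * s) \<le> real (t + 1)" by (simp only: of_nat_le_iff)
      \<comment> \<open>With \<open>t - 1\<close> instead of \<open>t\<close> in the bound, rounding
        up still halves the argument.\<close>
      then have st': "2 * (real s - 1) \<le> real t - 1" by simp
      have "real ?l = 2 * (2 ^ s + 1) * real l" by (simp add: algebra_simps)
      also have "\<dots> \<le> 2 * (2 ^ s + 1) * (3 / 2 * 2 ^ s * (real s - 1) powr log 2 7)"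
        using l(3) by (intro mult_left_mono) auto
      also have "\<dots> = 3 / 4 * (4 * (2 ^ s + 1)) * (2 ^ s * (real s - 1) powr log 2 7)"
        by simp
      also have "\<dots> \<le> 3 / 4 * (7 * 2 ^ s) * (2 ^ s * (real s - 1) powr log 2 7)"
        using * by (intro mult_right_mono mult_left_mono) auto
      also have "\<dots> = 3 / 4 * 2 ^ (2 * s) * (7 * (real s - 1) powr log 2 7)"
        by (simp add: power_add mult_2)
      also have "\<dots> \<le> 3 / 4 * 2 ^ (t + 1) * (real t - 1) powr log 2 7"
        using s st st' by (intro mult_mono log27_powr_bounds power_increasing) auto
      finally show ?thesis by simp
    qed
    ultimately show ?thesis using l(1) by (intro exI[of _ ?l]) auto
  qed
qed

lemma PSCA_upper:
  assumes "n \<ge> 3"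
  shows "\<exists>l>0. (\<exists>M. is_PSCA n 3 l M) \<and> real l \<le> 3 * real n * log 2 (real n) powr log 2 7"
proof -
  \<comment> \<open>The least \<open>t\<close> with \<open>n <= 2 ^ t\<close>: then
    \<open>2 ^ t <= 2 * n\<close>, which doubles 3/2 to 3, and \<open>t - 1\<close> is below the
    logarithm.\<close>
  define t where "t = nat \<lceil>log 2 (real n)\<rceil>"
  have "log 2 2 < log 2 (real n)" using assms by (subst log_less_cancel_iff) auto
  then have log: "log 2 (real n) > 1" by simp
  then have t: "log 2 (real n) \<le> real t" unfolding t_def by linarith
  have t': "real t - 1 < log 2 (real n)" using log unfolding t_def by linarith
  have "t \<ge> 2" using log t by linarith
  then obtain l where l: "l > 0" "balanceable {..<2 ^ t :: nat} l"
    "real l \<le> 3 / 2 * 2 ^ t * (real t - 1) powr log 2 7"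
    using balanceable_power2 by blast
  have "real n = 2 powr log 2 (real n)" using assms by simp
  also have "\<dots> \<le> 2 powr real t" using t by simp
  finally have "real n \<le> real (2 ^ t)" by (simp add: powr_realpow)
  then have "n \<le> 2 ^ t" by (simp only: of_nat_le_iff)
  then have "balanceable {1..n} l"
    by (intro balanceable_card_le[OF l(2)]) auto
  moreover have "real l \<le> 3 * real n * log 2 (real n) powr log 2 7"
  proof -
    have "2 powr real t = 2 * 2 powr (real t - 1)"
      by (simp add: powr_diff)
    also have "\<dots> \<le> 2 * 2 powr log 2 (real n)" using t' by simp
    finally have "2 ^ t \<le> 2 * real n" using assms by (simp add: powr_realpow)
    then have "3 / 2 * 2 ^ t * (real t - 1) powr log 2 7 \<le>
        3 / 2 * (2 * real n) * log 2 (real n) powr log 2 7"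
      using t' \<open>t \<ge> 2\<close> by (intro mult_mono powr_mono2) auto
    with l(3) show ?thesis by simp
  qed
  ultimately show ?thesis using l(1) balanceable_PSCA by blast
qed

section \<open>Lower bound\<close>

text \<open>Gaussian elimination, removing one equation and one unknown at a time.\<close>

lemma underdetermined_system:
  fixes v :: "'a \<Rightarrow> 'i \<Rightarrow> 'f :: field"
  assumes "finite I" "finite V" "card I < card V"
  shows "\<exists>c. (\<exists>x\<in>V. c x \<noteq> 0) \<and> (\<forall>i\<in>I. (\<Sum>x\<in>V. c x * v x i) = 0)"
  using assms
proof (induction I arbitrary: V v)
  case empty
  then obtain x where "x \<in> V" by fastforce
  then show ?case by (intro exI[of _ "\<lambda>_. 1"]) auto
next
  case (insert i I)
  show ?case
  proof (cases "\<forall>x\<in>V. v x i = 0")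
    case True
    with insert.IH[of V v] insert.prems insert.hyps show ?thesis by auto
  next
    case False
    then obtain p where p: "p \<in> V" "v p i \<noteq> 0" by blast
    \<comment> \<open>Subtracting a multiple of the pivot vector \<open>v p\<close> kills coordinate
      \<open>i\<close>; the coefficient of \<open>p\<close> in \<open>c'\<close> then undoes this
      subtraction in the sum.\<close>
    define w where "w = (\<lambda>x j. v x j - v x i / v p i * v p j)"
    have "card I < card (V - {p})"
      using insert.prems insert.hyps p by simp
    from insert.IH[OF _ this, of w] insert.prems obtain c where
      c: "\<exists>x\<in>V - {p}. c x \<noteq> 0" "\<And>j. j \<in> I \<Longrightarrow> (\<Sum>x\<in>V - {p}. c x * w x j) = 0" by auto
    define c' where "c' = c(p := - (\<Sum>x\<in>V - {p}. c x * (v x i / v p i)))"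
    have sum: "(\<Sum>x\<in>V. c' x * v x j) = (\<Sum>x\<in>V - {p}. c x * w x j)" for j
    proof -
      have "(\<Sum>x\<in>V. c' x * v x j) = c' p * v p j + (\<Sum>x\<in>V - {p}. c' x * v x j)"
        using insert.prems(1) p(1) by (rule sum.remove)
      also have "(\<Sum>x\<in>V - {p}. c' x * v x j) = (\<Sum>x\<in>V - {p}. c x * v x j)"
        by (intro sum.cong) (auto simp: c'_def)
      finally show ?thesis
        by (simp add: c'_def w_def sum_distrib_right sum_subtractf right_diff_distrib mult.assoc)
    qed
    moreover have "(\<Sum>x\<in>V - {p}. c x * w x i) = 0"
      using p by (intro sum.neutral) (simp add: w_def)
    moreover have "\<exists>x\<in>V. c' x \<noteq> 0"
      using c(1) by (auto simp: c'_def)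
    ultimately show ?thesis using c(2) by (intro exI[of _ c']) auto
  qed
qed

text \<open>If \<open>x\<close> precedes \<open>y\<close>, the third point \<open>z\<close> comes
  last, between them or first, in \<open>l\<close> orders each; reversing \<open>x\<close> and
  \<open>y\<close> doubles the count.\<close>

lemma covers_triples_card:
  assumes cov: "covers_triples A l I P" and A: "x \<in> A" "y \<in> A" "z \<in> A" "distinct [x, y, z]"
  shows "card {i\<in>I. P i x y} = 3 * l" "card I = 6 * l"
proof -
  have I: "finite I" and ord: "\<And>i. i \<in> I \<Longrightarrow> strict_order_on A (P i)"
    using cov by (auto simp: covers_triples_def)
  have pair: "card {i\<in>I. P i x y} = 3 * l" if "x \<in> A" "y \<in> A" "distinct [x, y, z]" for x y
  proof -
    have three: "card {i\<in>I. P i u v \<and> P i v w} = l" if "{u, v, w} = {x, y, z}" for u v w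
    proof -
      have "card {u, v, w} = 3" using that \<open>distinct [x, y, z]\<close> by simp
      then have "distinct [u, v, w]" by (auto simp: card_insert_if split: if_splits)
      moreover have "{u, v, w} \<subseteq> A"
        using that A(3) \<open>x \<in> A\<close> \<open>y \<in> A\<close> by simp
      ultimately show ?thesis using cov unfolding covers_triples_def by simp
    qed
    have ne: "x \<noteq> y" "x \<noteq> z" "y \<noteq> z" using that by auto
    have neg: "P i u v \<longleftrightarrow> \<not> P i v u" if "i \<in> I" "u \<in> A" "v \<in> A" "u \<noteq> v" for i u v
      using strict_order_on_not_iff[OF ord] that by blast
    note tr = strict_order_on_trans[OF ord]
    have "card {i\<in>I. P i x y} = card {i\<in>I. P i y z \<and> P i x y} + card {i\<in>I. \<not> P i y z \<and> P i x y}"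
      using I by (rule card_filter_split)
    also have "card {i\<in>I. \<not> P i y z \<and> P i x y} =
        card {i\<in>I. P i x z \<and> \<not> P i y z \<and> P i x y} + card {i\<in>I. \<not> P i x z \<and> \<not> P i y z \<and> P i x y}"
      using I by (rule card_filter_split)
    also have "{i\<in>I. P i x z \<and> \<not> P i y z \<and> P i x y} = {i\<in>I. P i x z \<and> P i z y}"
      using neg[OF _ that(2) A(3) ne(3)] tr[of _ x z y] that A(3) by blast
    also have "{i\<in>I. \<not> P i x z \<and> \<not> P i y z \<and> P i x y} = {i\<in>I. P i z x \<and> P i x y}"
      using neg[OF _ that(1) A(3) ne(2)] neg[OF _ that(2) A(3) ne(3)] tr[of _ z x y] that A(3) by blast
    finally show ?thesis
      using three[of x y z] three[of x z y] three[of z x y] by (simp add: insert_commute conj_commute)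
  qed
  show "card {i\<in>I. P i x y} = 3 * l" using pair A by simp
  have "{i\<in>I. \<not> P i x y \<and> True} = {i\<in>I. P i y x}"
    using strict_order_on_not_iff[OF ord, of _ x y] A by auto
  moreover have "y \<noteq> x" using A by auto
  ultimately show "card I = 6 * l"
    using card_filter_split[OF I, of "\<lambda>_. True" "\<lambda>i. P i x y"] pair[of x y] pair[of y x] A by simp
qed

text \<open>A linear dependence paired with each of its vectors yields equations in the Gram matrix
  that force it to be trivial. Positivity of \<open>l\<close> excludes the empty family.\<close>

lemma covers_triples_lower:
  assumes cov: "covers_triples A l I P" and A: "finite A" "card A \<ge> 3" and "l > 0"
  shows "card A \<le> 6 * l"
proof (rule ccontr)
  assume "\<not> card A \<le> 6 * l"
  have I: "finite I" and ord: "\<And>i. i \<in> I \<Longrightarrow> strict_order_on A (P i)"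
    and triple: "\<And>x y z. x \<in> A \<Longrightarrow> y \<in> A \<Longrightarrow> z \<in> A \<Longrightarrow> distinct [x, y, z] \<Longrightarrow> card {i\<in>I. P i x y \<and> P i y z} = l"
    using cov unfolding covers_triples_def by blast+
  have third: "\<exists>z\<in>A. z \<noteq> x \<and> z \<noteq> y" for x y
  proof (rule ccontr)
    assume "\<not> ?thesis"
    then have "card A \<le> card {x, y}" by (intro card_mono) auto
    also have "\<dots> \<le> 2" by (simp add: card_insert_if)
    finally show False using A by simp
  qed
  obtain z where z: "z \<in> A" using third by blast
  have pair: "card {i\<in>I. P i x y} = 3 * l" and cardI: "card I = 6 * l"
    if "x \<in> A" "y \<in> A" "x \<noteq> y" for x y
  proof -
    obtain w where "w \<in> A" "w \<noteq> x" "w \<noteq> y" using third by blast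
    then show "card {i\<in>I. P i x y} = 3 * l" "card I = 6 * l"
      using covers_triples_card[OF cov, of x y w] that by auto
  qed
  have cardI: "card I = 6 * l" using third[of z z] cardI[OF _ z] by blast
  \<comment> \<open>The index \<open>z\<close> itself carries the all-ones vector, so there are
    \<open>card A\<close> vectors in all.\<close>
  define u :: "'a \<Rightarrow> 'b \<Rightarrow> real" where
    "u = (\<lambda>x i. if x = z then 1 else 1 - 2 * of_bool (P i x z))"
  have count: "(\<Sum>i\<in>I. of_bool (Q i)) = real (card {i\<in>I. Q i})" for Q
    using I by (simp add: Int_def)
  have uz: "(\<Sum>i\<in>I. u x i * u z i) = 0" if "x \<in> A" "x \<noteq> z" for x
    using that pair[OF that(1) z that(2)] cardI
    by (simp add: u_def sum_subtractf count flip: sum_distrib_left del: sum_of_bool_eq)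
  have uxy: "(\<Sum>i\<in>I. u x i * u y i) = 2 * real l" if xy: "x \<in> A" "x \<noteq> z" "y \<in> A" "y \<noteq> z" "x \<noteq> y" for x y
  proof -
    \<comment> \<open>The signs differ exactly when \<open>z\<close> lies between \<open>x\<close>
      and \<open>y\<close>, which happens in \<open>2 * l\<close> of the \<open>6 * l\<close>
      orders.\<close>
    have "u x i * u y i = 1 - 2 * of_bool (P i x z \<and> P i z y) - 2 * of_bool (P i y z \<and> P i z x)"
      if i: "i \<in> I" for i
      using strict_order_on_not_iff[OF ord[OF i] z, of x] strict_order_on_not_iff[OF ord[OF i] z, of y] xy
      by (auto simp: u_def)
    then have "(\<Sum>i\<in>I. u x i * u y i) =
        real (card I) - 2 * real (card {i\<in>I. P i x z \<and> P i z y}) - 2 * real (card {i\<in>I. P i y z \<and> P i z x})"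
      by (simp add: sum_subtractf count flip: sum_distrib_left del: sum_of_bool_eq)
    also have "\<dots> = 2 * real l"
      using triple[of x z y] triple[of y z x] z xy cardI by simp
    finally show ?thesis .
  qed
  have uxx: "(\<Sum>i\<in>I. u x i * u x i) = 6 * real l" for x
  proof -
    have "u x i * u x i = 1" for i by (simp add: u_def)
    then show ?thesis by (simp add: cardI)
  qed
  obtain c where c0: "\<exists>x\<in>A. c x \<noteq> 0" and c: "\<And>i. i \<in> I \<Longrightarrow> (\<Sum>x\<in>A. c x * u x i) = 0"
    using underdetermined_system[OF I A(1), of u] cardI \<open>\<not> card A \<le> 6 * l\<close> by auto
  have gram: "(\<Sum>x\<in>A. c x * (\<Sum>i\<in>I. u x i * u y i)) = 0" for y
  proof -
    have "(\<Sum>x\<in>A. c x * (\<Sum>i\<in>I. u x i * u y i)) = (\<Sum>x\<in>A. \<Sum>i\<in>I. c x * u x i * u y i)"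
      by (simp add: sum_distrib_left mult.assoc)
    also have "\<dots> = (\<Sum>i\<in>I. \<Sum>x\<in>A. c x * u x i * u y i)" by (rule sum.swap)
    also have "\<dots> = (\<Sum>i\<in>I. (\<Sum>x\<in>A. c x * u x i) * u y i)" by (simp add: sum_distrib_right)
    also have "\<dots> = 0" using c by simp
    finally show ?thesis .
  qed
  define S where "S = (\<Sum>x\<in>A - {z}. c x)"
  have "(\<Sum>x\<in>A. c x * (\<Sum>i\<in>I. u x i * u z i)) = c z * (6 * real l)"
    by (subst sum.remove[OF A(1) z]) (simp add: uxx uz)
  then have cz: "c z = 0" using gram[of z] \<open>l > 0\<close> by simp
  \<comment> \<open>Row \<open>y\<close> of the Gram system reads
    \<open>6l c(y) + 2l (S - c(y)) = 0\<close>; adding all these rows then forces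
    \<open>S = 0\<close>.\<close>
  have cy: "2 * c y + S = 0" if y: "y \<in> A - {z}" for y
  proof -
    have "(\<Sum>x\<in>A. c x * (\<Sum>i\<in>I. u x i * u y i)) = (\<Sum>x\<in>A - {z}. c x * (\<Sum>i\<in>I. u x i * u y i))"
      by (subst sum.remove[OF A(1) z]) (simp add: cz)
    also have "\<dots> = c y * (6 * real l) + (\<Sum>x\<in>A - {z} - {y}. c x * (\<Sum>i\<in>I. u x i * u y i))"
      by (subst sum.remove[OF _ y]) (use A in \<open>auto simp: uxx\<close>)
    also have "(\<Sum>x\<in>A - {z} - {y}. c x * (\<Sum>i\<in>I. u x i * u y i)) = (\<Sum>x\<in>A - {z} - {y}. c x * (2 * real l))"
      using y by (intro sum.cong) (auto simp: uxy)
    also have "\<dots> = (S - c y) * (2 * real l)"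
      unfolding S_def using sum.remove[OF _ y, of c] A by (simp flip: sum_distrib_right)
    finally have "2 * real l * (2 * c y + S) = 0" using gram[of y] by (simp add: algebra_simps)
    then show ?thesis using \<open>l > 0\<close> by simp
  qed
  have "(2 + real (card (A - {z}))) * S = (\<Sum>y\<in>A - {z}. 2 * c y + S)"
    by (simp add: sum.distrib S_def distrib_right flip: sum_distrib_left)
  then have "(2 + real (card (A - {z}))) * S = 0" using cy by simp
  moreover have "2 + real (card (A - {z})) > 0" by (simp add: add_pos_nonneg)
  ultimately have "S = 0" by simp
  with cy cz have "c x = 0" if "x \<in> A" for x
    using that by (cases "x = z") force+
  with c0 show False by blast
qed

theorem theorem2:
  shows "\<exists>C::real. \<forall>n::nat. n \<ge> 3 \<longrightarrow>
           real n / 6 \<le> real (g n 3) \<and>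
           real (g n 3) \<le> C * real n * (log 2 (real n)) powr (log 2 7)"
proof (intro exI[of _ 3] allI impI conjI)
  fix n :: nat assume n: "n \<ge> 3"
  obtain l where l: "l > 0 \<and> (\<exists>M. is_PSCA n 3 l M)"
    "real l \<le> 3 * real n * log 2 (real n) powr log 2 7"
    using PSCA_upper[OF n] by blast
  have "g n 3 \<le> l" unfolding g_def using l(1) by (rule Least_le)
  then show "real (g n 3) \<le> 3 * real n * log 2 (real n) powr log 2 7"
    using l(2) by linarith
  \<comment> \<open>The least multiplicity is attained because the upper bound has supplied
    one.\<close>
  have "g n 3 > 0 \<and> (\<exists>M. is_PSCA n 3 (g n 3) M)"
    unfolding g_def using l(1) by (rule LeastI)
  then obtain I :: "nat set" and P where "covers_triples {1..n} (g n 3) I P" "g n 3 > 0"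
    using PSCA_covers_triples by blast
  then have "n \<le> 6 * g n 3"
    using covers_triples_lower[of "{1..n}" "g n 3" I P] n by simp
  then show "real n / 6 \<le> real (g n 3)" by linarith
qed

end
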